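(* Let $X$ be a real Hilbert space, $\alpha>0$, $A:X\to X$ $\alpha$-cocoercive and $B:X\rightrightarrows X$ maximal monotone. Let $0<\underline\lambda\le\bar\lambda<2\alpha$, let $(\lambda_k)_{k\ge1}$ be a sequence in $[\underline\lambda,\bar\lambda]$, let $x_0\in X$, and let $(x_k)$ be generated by the Forward-Backward splitting method $$x_k=(I+\lambda_kB)^{-1}\bigl(x_{k-1}-\lambda_kA(x_{k-1})\bigr),\qquad k=1,2,\dots$$ Define $$\sigma=\sqrt{\frac{\bar\lambda}{2\alpha}},\qquad v_k=\lambda_k^{-1}(x_{k-1}-x_k),\qquad \varepsilon_k=\frac{\|x_k-x_{k-1}\|^2}{4\alpha},\qquad k=1,2,\dots$$ Then $0<\sigma<1$ and for $k=1,2,\dots$ $$v_k\in(A+B)^{[\varepsilon_k]}(x_k),\qquad \|\lambda_kv_k+x_k-x_{k-1}\|^2+2\lambda_k\varepsilon_k\le\sigma^2\|x_k-x_{k-1}\|^2,\qquad x_k=x_{k-1}-\lambda_kv_k.$$ In particular, the Forward-Backward splitting method is a particular case of the Hybrid Proximal-Extragradient method for $T=A+B$ with $\sigma\in(0,1)$.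
   Context: $A:X\to X$ is $\alpha$-cocoercive if $\langle x-y,Ax-Ay\rangle\ge\alpha\|Ax-Ay\|^2$ for all $x,y\in X$. For maximal monotone $T:X\rightrightarrows X$ (point-to-set) and $\varepsilon\ge 0$, $$T^{[\varepsilon]}(x)=\{v\in X : \langle x-y,v-u\rangle\ge-\varepsilon\ \text{ for all } y\in X,\ u\in T(y)\}.$$ The Hybrid Proximal-Extragradient (HPE) method for $0\in T(x)$, with $x_0\in X$, $\sigma\in[0,1)$, $\underline\lambda>0$: for $k=1,2,\dots$, (a) choose $\lambda_k\ge\underline\lambda$ and find $v_k,y_k\in X$, $\varepsilon_k\ge0$ such that $v_k\in T^{[\varepsilon_k]}(y_k)$ and $\|\lambda_kv_k+y_k-x_{k-1}\|^2+2\lambda_k\varepsilon_k\le\sigma^2\|y_k-x_{k-1}\|^2$; (b) set $x_k=x_{k-1}-\lambda_kv_k$. (Here the steps are satisfied with $y_k=x_k$.) *)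

theory Defs
  imports "HOL-Analysis.Analysis"
begin

text \<open>
  Point-to-set operators on \<open>X\<close> are functions \<open>'a \<Rightarrow> 'a set\<close>. A real Hilbert space is a type of
  sort \<open>{real_inner, complete_space}\<close>.
\<close>

definition cocoercive :: "real \<Rightarrow> ('a::real_inner \<Rightarrow> 'a) \<Rightarrow> bool" where
  "cocoercive \<alpha> A \<longleftrightarrow> (\<forall>x y. inner (x - y) (A x - A y) \<ge> \<alpha> * (norm (A x - A y))\<^sup>2)"

definition monotone_operator :: "('a::real_inner \<Rightarrow> 'a set) \<Rightarrow> bool" where
  "monotone_operator T \<longleftrightarrow>
     (\<forall>x y. \<forall>v\<in>T x. \<forall>u\<in>T y. inner (x - y) (v - u) \<ge> 0)"

definition maximal_monotone :: "('a::real_inner \<Rightarrow> 'a set) \<Rightarrow> bool" where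
  "maximal_monotone T \<longleftrightarrow>
     monotone_operator T \<and>
     (\<forall>S. monotone_operator S \<and> (\<forall>x. T x \<subseteq> S x) \<longrightarrow> S = T)"

definition single_valued_op :: "('a \<Rightarrow> 'a) \<Rightarrow> 'a \<Rightarrow> 'a set" where
  "single_valued_op A x = {A x}"

definition op_sum :: "('a::plus \<Rightarrow> 'a set) \<Rightarrow> ('a \<Rightarrow> 'a set) \<Rightarrow> 'a \<Rightarrow> 'a set" where
  "op_sum S T x = {s + t | s t. s \<in> S x \<and> t \<in> T x}"

definition op_scale :: "real \<Rightarrow> ('a::real_vector \<Rightarrow> 'a set) \<Rightarrow> 'a \<Rightarrow> 'a set" where
  "op_scale c T x = {c *\<^sub>R t | t. t \<in> T x}"

definition op_inverse :: "('a \<Rightarrow> 'a set) \<Rightarrow> 'a \<Rightarrow> 'a set" where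
  "op_inverse T z = {x. z \<in> T x}"

definition resolvent :: "real \<Rightarrow> ('a::real_vector \<Rightarrow> 'a set) \<Rightarrow> 'a \<Rightarrow> 'a set" where
  "resolvent c B = op_inverse (op_sum (single_valued_op (\<lambda>x. x)) (op_scale c B))"

definition enlargement :: "('a::real_inner \<Rightarrow> 'a set) \<Rightarrow> real \<Rightarrow> 'a \<Rightarrow> 'a set" where
  "enlargement T \<epsilon> x = {v. \<forall>y. \<forall>u\<in>T y. inner (x - y) (v - u) \<ge> - \<epsilon>}"

text \<open>
  In both methods only the indices \<open>k \<ge> 1\<close> of the sequences \<open>lam\<close>, \<open>v\<close>, \<open>y\<close>, \<open>\<epsilon>\<close> matter; \<open>x\<close> is
  indexed from \<open>0\<close>. The resolvent is written as a point-to-set operator. For monotone \<open>B\<close> and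
  \<open>c > 0\<close> its values have at most one element, so that membership is the equation
  \<open>x\<^sub>k = (I + lam\<^sub>k B)\<inverse> (\<dots>)\<close>.
\<close>

definition forward_backward ::
  "('a::real_vector \<Rightarrow> 'a) \<Rightarrow> ('a \<Rightarrow> 'a set) \<Rightarrow> (nat \<Rightarrow> real) \<Rightarrow> 'a \<Rightarrow> (nat \<Rightarrow> 'a) \<Rightarrow> bool" where
  "forward_backward A B lam x0 x \<longleftrightarrow>
     x 0 = x0 \<and>
     (\<forall>k\<ge>1. x k \<in> resolvent (lam k) B (x (k - 1) - lam k *\<^sub>R A (x (k - 1))))"

text \<open>
  The method is posed for maximal monotone \<open>T\<close>, so maximal monotonicity of \<open>T\<close> is part of
  the predicate, as are the requirements on \<open>\<sigma>\<close> and on the lower bound \<open>lam_low\<close> of the stepsizes.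
\<close>

definition hybrid_proximal_extragradient ::
  "('a::real_inner \<Rightarrow> 'a set) \<Rightarrow> real \<Rightarrow> real \<Rightarrow> 'a \<Rightarrow> (nat \<Rightarrow> real) \<Rightarrow> (nat \<Rightarrow> 'a) \<Rightarrow> (nat \<Rightarrow> 'a) \<Rightarrow>
   (nat \<Rightarrow> real) \<Rightarrow> (nat \<Rightarrow> 'a) \<Rightarrow> bool" where
  "hybrid_proximal_extragradient T \<sigma> lam_low x0 lam v y \<epsilon> x \<longleftrightarrow>
     maximal_monotone T \<and> 0 \<le> \<sigma> \<and> \<sigma> < 1 \<and> 0 < lam_low \<and> x 0 = x0 \<and>
     (\<forall>k\<ge>1. lam_low \<le> lam k \<and> 0 \<le> \<epsilon> k \<and>
        v k \<in> enlargement T (\<epsilon> k) (y k) \<and>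
        (norm (lam k *\<^sub>R v k + y k - x (k - 1)))\<^sup>2 + 2 * lam k * \<epsilon> k
          \<le> \<sigma>\<^sup>2 * (norm (y k - x (k - 1)))\<^sup>2 \<and>
        x k = x (k - 1) - lam k *\<^sub>R v k)"

end

theory Submission
  imports Defs
begin

text \<open>
  The enlargement inclusion comes from completing the square in
  \<open>\<langle>x\<^sub>k - y, A x\<^sub>k\<^sub>-\<^sub>1 - A y\<rangle> \<ge> \<alpha> \<parallel>A x\<^sub>k\<^sub>-\<^sub>1 - A y\<parallel>\<^sup>2 + \<langle>x\<^sub>k - x\<^sub>k\<^sub>-\<^sub>1, A x\<^sub>k\<^sub>-\<^sub>1 - A y\<rangle>\<close>.
  The substantial point is the maximality of \<open>A + B\<close>, which rests on Minty's theorem for \<open>B\<close>. Let \<open>F\<close> be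
  the Fitzpatrick function of a maximal monotone graph \<open>G\<close>. The strongly convex function
  \<open>F + \<parallel>\<cdot>\<parallel>\<^sup>2 / 2\<close> attains its minimum at some \<open>(x, u)\<close>, and the optimality condition there says that
  \<open>(-u, -x)\<close> is monotonically related to \<open>G\<close>, hence lies in it; testing the condition at this very
  point gives \<open>x + u = 0\<close>. If now \<open>(x, v)\<close> is monotonically related to the graph of
  \<open>A + B\<close>, one solves \<open>y + t b = x + t (v - A x)\<close> with \<open>b \<in> B y\<close> for a small \<open>t > 0\<close>;
  the Lipschitz continuity of \<open>A\<close> forces \<open>y = x\<close>.
\<close>

section \<open>Proximal points of convex functions\<close>

lemma norm_add_scaleR_sq:
  fixes a b :: "'a::real_inner"
  shows "(norm (a + t *\<^sub>R b))\<^sup>2 = (norm a)\<^sup>2 + 2 * t * inner a b + t\<^sup>2 * (norm b)\<^sup>2"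
  unfolding power2_norm_eq_inner
  by (simp add: inner_simps inner_commute power2_eq_square algebra_simps)

lemma norm_midpoint_sq:
  fixes a b :: "'a::real_inner"
  shows "(norm (midpoint a b))\<^sup>2 = (norm a)\<^sup>2 / 2 + (norm b)\<^sup>2 / 2 - (norm (a - b))\<^sup>2 / 4"
  by (simp add: midpoint_def power2_norm_eq_inner inner_simps inner_commute field_simps)

text \<open>
  A proximal point of an extended-valued convex function, which enters through its epigraph \<open>S\<close>.
\<close>

lemma proximal_point_exists:
  fixes S :: "('h::{real_inner, complete_space} \<times> real) set"
  assumes "closed S" "convex S" "S \<noteq> {}"
    and bounded: "\<And>z r. (z, r) \<in> S \<Longrightarrow> c \<le> r + (norm z)\<^sup>2 / 2"
  obtains z r where "(z, r) \<in> S" "\<And>z' r'. (z', r') \<in> S \<Longrightarrow> 0 \<le> r' - r + inner z (z' - z)"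
proof -
  define f :: "'h \<times> real \<Rightarrow> real" where "f p = snd p + (norm (fst p))\<^sup>2 / 2" for p
  define m where "m = (INF p\<in>S. f p)"
  have bdd: "bdd_below (f ` S)"
    using bounded by (intro bdd_belowI2[of _ c]) (auto simp: f_def)
  have m_le: "m \<le> f p" if "p \<in> S" for p
    unfolding m_def using bdd that by (rule cINF_lower)
  have "\<exists>p\<in>S. f p < m + inverse (Suc n)" for n
    using cInf_lessD[of "f ` S" "m + inverse (Suc n)"] \<open>S \<noteq> {}\<close> by (auto simp: m_def)
  then obtain p where pS: "\<And>n. p n \<in> S" and pm: "\<And>n. f (p n) < m + inverse (Suc n)"
    by metis
  \<comment> \<open>Strong convexity: at the midpoint \<open>f\<close> lies below the average of the
    two values by an eighth of the squared distance, yet not below \<open>m\<close>. This makes the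
    minimizing sequence Cauchy.\<close>
  have close: "(norm (fst (p i) - fst (p j)))\<^sup>2 / 4 \<le> inverse (Suc i) + inverse (Suc j)" for i j
  proof -
    have "midpoint (p i) (p j) \<in> S"
      using convexD[OF \<open>convex S\<close> pS[of i] pS[of j], of "1/2" "1/2"]
      by (simp add: midpoint_def scaleR_add_right)
    then have "m \<le> f (midpoint (p i) (p j))" by (rule m_le)
    also have "\<dots> = f (p i) / 2 + f (p j) / 2 - (norm (fst (p i) - fst (p j)))\<^sup>2 / 8"
    proof -
      have "fst (midpoint (p i) (p j)) = midpoint (fst (p i)) (fst (p j))"
        by (simp add: midpoint_def)
      then show ?thesis
        unfolding f_def by (simp add: norm_midpoint_sq) (simp add: midpoint_def field_simps)
    qed
    finally show ?thesis using pm[of i] pm[of j] by argo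
  qed
  have "Cauchy (\<lambda>n. fst (p n))"
  proof (rule metric_CauchyI)
    fix e :: real assume "e > 0"
    then obtain N where N: "inverse (Suc N) < e\<^sup>2 / 8"
      using reals_Archimedean[of "e\<^sup>2 / 8"] by auto
    show "\<exists>M. \<forall>i\<ge>M. \<forall>j\<ge>M. dist (fst (p i)) (fst (p j)) < e"
    proof (intro exI allI impI)
      fix i j assume "N \<le> i" "N \<le> j"
      then have "inverse (Suc i) \<le> inverse (Suc N)" "inverse (Suc j) \<le> inverse (Suc N)"
        by (auto intro!: le_imp_inverse_le)
      then have "(norm (fst (p i) - fst (p j)))\<^sup>2 < e\<^sup>2"
        using close[of i j] N by linarith
      then show "dist (fst (p i)) (fst (p j)) < e"
        using \<open>e > 0\<close> by (simp add: dist_norm power_less_imp_less_base)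
    qed
  qed
  then obtain z where z: "(\<lambda>n. fst (p n)) \<longlonglongrightarrow> z"
    using Cauchy_convergent convergent_def by blast
  \<comment> \<open>The height for which \<open>f (z, r) = m\<close>; the heights
    \<open>snd (p n)\<close> tend to it because \<open>f (p n)\<close> and the norms both
    converge.\<close>
  define r where "r = m - (norm z)\<^sup>2 / 2"
  have "(\<lambda>n. f (p n)) \<longlonglongrightarrow> m"
  proof (rule tendsto_sandwich[of "\<lambda>_. m"])
    show "(\<lambda>n. m + inverse (Suc n)) \<longlonglongrightarrow> m"
      using LIMSEQ_inverse_real_of_nat_add by simp
  qed (use pm pS m_le in \<open>auto intro!: always_eventually less_imp_le\<close>)
  then have "(\<lambda>n. f (p n) - (norm (fst (p n)))\<^sup>2 / 2) \<longlonglongrightarrow> r"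
    unfolding r_def by (intro tendsto_intros z) simp_all
  then have "(\<lambda>n. snd (p n)) \<longlonglongrightarrow> r"
    by (simp add: f_def)
  with z have "(\<lambda>n. (fst (p n), snd (p n))) \<longlonglongrightarrow> (z, r)"
    by (rule tendsto_Pair)
  then have zr: "(z, r) \<in> S"
    using closed_sequentially[OF \<open>closed S\<close>, of "\<lambda>n. (fst (p n), snd (p n))"] pS by simp
  show thesis
  proof
    show "(z, r) \<in> S" by fact
    fix z' r' assume zr': "(z', r') \<in> S"
    let ?d = "r' - r + inner z (z' - z)"
    \<comment> \<open>The difference quotient of \<open>f\<close> from \<open>(z, r)\<close> towards
      \<open>(z', r')\<close>: nonnegative by minimality, and \<open>t\<close> is sent to
      \<open>0\<close>.\<close>
    let ?g = "\<lambda>t::real. ?d + t * (norm (z' - z))\<^sup>2 / 2"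
    have "0 \<le> ?g t" if "0 < t" "t \<le> 1" for t
    proof -
      have "(1 - t) *\<^sub>R (z, r) + t *\<^sub>R (z', r') \<in> S"
        using that by (intro convexD[OF \<open>convex S\<close> zr zr']) auto
      then have "m \<le> f ((1 - t) *\<^sub>R (z, r) + t *\<^sub>R (z', r'))" by (rule m_le)
      also have "(1 - t) *\<^sub>R (z, r) + t *\<^sub>R (z', r') = (z + t *\<^sub>R (z' - z), r + t * (r' - r))"
        by (simp add: algebra_simps)
      also have "f \<dots> = m + t * ?g t"
        unfolding f_def r_def fst_conv snd_conv norm_add_scaleR_sq
        by (simp add: ring_distribs power2_eq_square add_divide_distrib)
      finally have "0 \<le> t * ?g t" by simp
      then show ?thesis using \<open>0 < t\<close> zero_le_mult_iff[of t "?g t"] by auto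
    qed
    moreover have "(?g \<longlongrightarrow> ?g 0) (at_right 0)"
      by (intro tendsto_intros) simp
    ultimately have "0 \<le> ?g 0"
      by (intro tendsto_lowerbound[of ?g _ "at_right 0"])
        (auto simp: eventually_at_right_field intro!: exI[of _ 1])
    then show "0 \<le> ?d" by simp
  qed
qed

section \<open>Fitzpatrick function and Minty's theorem\<close>

text \<open>
  \<open>S\<close> below is the epigraph of the Fitzpatrick function
  \<open>F (x, u) = sup {\<langle>x, w\<rangle> + \<langle>y, u\<rangle> - \<langle>y, w\<rangle> | (y, w) \<in> G}\<close>.
\<close>

lemma maximal_monotone_graph_meets_antidiagonal:
  fixes G :: "('a::{real_inner, complete_space} \<times> 'a) set"
  assumes mono: "\<And>x u y w. (x, u) \<in> G \<Longrightarrow> (y, w) \<in> G \<Longrightarrow> 0 \<le> inner (x - y) (u - w)"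
    and max: "\<And>x u. (\<And>y w. (y, w) \<in> G \<Longrightarrow> 0 \<le> inner (x - y) (u - w)) \<Longrightarrow> (x, u) \<in> G"
  obtains x where "(x, - x) \<in> G"
proof -
  define aff where "aff p q = inner (fst p) (snd q) + inner (fst q) (snd p) - inner (fst q) (snd q)"
    for p q :: "'a \<times> 'a"
  define S where "S = (\<Inter>q\<in>G. {(p, r). aff p q \<le> r})"
  have aff_diff: "inner (fst p - fst q) (snd p - snd q) = inner (fst p) (snd p) - aff p q" for p q
    by (simp add: aff_def inner_simps)
  have in_S: "(p, inner (fst p) (snd p)) \<in> S" if "p \<in> G" for p
    using mono[of "fst p" "snd p"] that aff_diff[of p] by (fastforce simp: S_def)
  \<comment> \<open>Off \<open>G\<close>, maximality supplies some \<open>q\<close> in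
    \<open>G\<close> not monotonically related to \<open>p\<close>, and then \<open>aff p q\<close>
    exceeds the pairing.\<close>
  have S_ge: "inner (fst p) (snd p) \<le> r" if "(p, r) \<in> S" for p r
  proof (cases "p \<in> G")
    case True
    then have "aff p p \<le> r" using that by (auto simp: S_def)
    then show ?thesis by (simp add: aff_def)
  next
    case False
    then obtain q where "q \<in> G" "inner (fst p - fst q) (snd p - snd q) < 0"
      using max[of "fst p" "snd p"] by fastforce
    moreover from this have "aff p q \<le> r" using that by (auto simp: S_def)
    ultimately show ?thesis using aff_diff[of p q] by linarith
  qed
  have "closed S"
    unfolding S_def aff_def case_prod_unfold
    by (intro closed_INT ballI closed_Collect_le continuous_intros)
  moreover have "convex S"
  proof -
    have "convex {(p, r). aff p q \<le> r}" for q
    proof (rule convexI, clarsimp)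
      fix a b c d :: 'a and r s u v :: real
      assume "0 \<le> u" "0 \<le> v" and uv: "u + v = 1" and "aff (a, b) q \<le> r" "aff (c, d) q \<le> s"
      then have "u * aff (a, b) q + v * aff (c, d) q \<le> u * r + v * s"
        by (intro add_mono mult_left_mono)
      moreover have "aff (u *\<^sub>R a + v *\<^sub>R c, u *\<^sub>R b + v *\<^sub>R d) q = u * aff (a, b) q + v * aff (c, d) q"
      proof -
        have v: "v = 1 - u" using uv by simp
        show ?thesis unfolding v by (simp add: aff_def inner_simps algebra_simps)
      qed
      ultimately show "aff (u *\<^sub>R a + v *\<^sub>R c, u *\<^sub>R b + v *\<^sub>R d) q \<le> u * r + v * s" by simp
    qed
    then show ?thesis unfolding S_def by (intro convex_INT)
  qed
  \<comment> \<open>For empty \<open>G\<close> the premise of \<open>max\<close> would hold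
    vacuously and put every pair into \<open>G\<close>.\<close>
  moreover have "S \<noteq> {}"
    using max in_S by (metis emptyE)
  moreover have "0 \<le> r + (norm p)\<^sup>2 / 2" if "(p, r) \<in> S" for p r
  proof -
    have "0 \<le> (norm (fst p + snd p))\<^sup>2 / 2" by simp
    also have "\<dots> = inner (fst p) (snd p) + (norm p)\<^sup>2 / 2"
      by (simp add: power2_norm_eq_inner inner_prod_def inner_simps inner_commute field_simps)
    finally show ?thesis using S_ge[OF that] by simp
  qed
  ultimately obtain z r where zr: "(z, r) \<in> S"
    and opt: "\<And>z' r'. (z', r') \<in> S \<Longrightarrow> 0 \<le> r' - r + inner z (z' - z)"
    using proximal_point_exists[of S 0] by metis
  obtain x u where z: "z = (x, u)" by fastforce
  \<comment> \<open>Optimality is tested at a point of \<open>G\<close> with its pairing as height,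
    and \<open>S_ge\<close> gives \<open>inner x u \<le> r\<close>. The square kept on the left
    later forces \<open>x + u = 0\<close>.\<close>
  have related: "(norm (x + u))\<^sup>2 \<le> inner (- u - y) (- x - w)" if "(y, w) \<in> G" for y w
    using opt[OF in_S[OF that]] S_ge[OF zr] z
    by (simp add: power2_norm_eq_inner inner_simps inner_commute)
  then have G: "(- u, - x) \<in> G"
    by (intro max) (meson order_trans zero_le_power2)
  from related[OF this] have "x + u = 0" by simp
  then have "- u = x" by (simp add: add_eq_0_iff2)
  with G that show thesis by simp
qed

text \<open>Adjoining one monotonically related pair to the graph already gives a monotone
  extension; conversely, every pair of a monotone extension is related to the graph of
  \<open>T\<close>.\<close>

lemma maximal_monotone_iff:
  "maximal_monotone T \<longleftrightarrow> monotone_operator T \<and>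
     (\<forall>x v. (\<forall>y. \<forall>u\<in>T y. 0 \<le> inner (x - y) (v - u)) \<longrightarrow> v \<in> T x)"
proof safe
  assume T: "maximal_monotone T"
  then show mono: "monotone_operator T" by (simp add: maximal_monotone_def)
  fix x v assume rel: "\<forall>y. \<forall>u\<in>T y. 0 \<le> inner (x - y) (v - u)"
  have "0 \<le> inner (y - z) (u - w)"
    if uw: "u \<in> (T(x := insert v (T x))) y" "w \<in> (T(x := insert v (T x))) z" for y z u w
  proof -
    consider "u \<in> T y" "w \<in> T z" | "y = x" "u = v" "w \<in> T z" | "u \<in> T y" "z = x" "w = v"
      | "y = x" "u = v" "z = x" "w = v"
      using uw by (auto split: if_splits)
    then show ?thesis
    proof cases
      case 1
      with mono show ?thesis unfolding monotone_operator_def by blast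
    next
      case 3
      with rel have "0 \<le> inner (x - y) (v - u)" by blast
      with 3 show ?thesis by (simp add: inner_simps)
    qed (use rel in simp_all)
  qed
  then have "monotone_operator (T(x := insert v (T x)))"
    unfolding monotone_operator_def by blast
  then have "T(x := insert v (T x)) = T"
    using T unfolding maximal_monotone_def by (metis fun_upd_apply order_refl subset_insertI)
  then show "v \<in> T x" by (metis fun_upd_same insertI1)
next
  assume mono: "monotone_operator T"
    and max: "\<forall>x v. (\<forall>y. \<forall>u\<in>T y. 0 \<le> inner (x - y) (v - u)) \<longrightarrow> v \<in> T x"
  have "S = T" if S: "monotone_operator S" "\<forall>x. T x \<subseteq> S x" for S
  proof (intro ext subset_antisym subsetI)
    fix x v assume "v \<in> S x"
    then show "v \<in> T x" using max S unfolding monotone_operator_def by blast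
  qed (use S in auto)
  then show "maximal_monotone T" unfolding maximal_monotone_def using mono by blast
qed

text \<open>Scaling by \<open>t\<close> and translating by \<open>p\<close> preserve maximality. The
  previous result thus applies to the graph of \<open>t B - p\<close>, where \<open>(y, - y)\<close>
  means that \<open>(p - y) / t\<close> lies in \<open>B y\<close>; \<open>h\<close> undoes the
  scaling and the shift.\<close>

lemma minty:
  fixes B :: "'a::{real_inner, complete_space} \<Rightarrow> 'a set"
  assumes B: "maximal_monotone B" and t: "0 < t"
  obtains y b where "b \<in> B y" "y + t *\<^sub>R b = p"
proof -
  define h where "h w = inverse t *\<^sub>R (w + p)" for w
  have h_inner: "inner a (h u - h w) = inverse t * inner a (u - w)" for a u w
    by (simp add: h_def scaleR_diff_right[symmetric] inner_simps)
  have h_inv: "h (t *\<^sub>R b - p) = b" for b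
    using t by (simp add: h_def)
  obtain y where "(y, - y) \<in> {(y, w). h w \<in> B y}"
  proof (rule maximal_monotone_graph_meets_antidiagonal)
    fix x u y w
    assume "(x, u) \<in> {(y, w). h w \<in> B y}" "(y, w) \<in> {(y, w). h w \<in> B y}"
    then have "0 \<le> inner (x - y) (h u - h w)"
      using B by (auto simp: maximal_monotone_def monotone_operator_def)
    then show "0 \<le> inner (x - y) (u - w)"
      using t by (simp add: h_inner zero_le_mult_iff)
  next
    fix x u
    assume rel: "\<And>y w. (y, w) \<in> {(y, w). h w \<in> B y} \<Longrightarrow> 0 \<le> inner (x - y) (u - w)"
    have "0 \<le> inner (x - y) (h u - b)" if "b \<in> B y" for y b
      using rel[of y "t *\<^sub>R b - p"] h_inner[of "x - y" u "t *\<^sub>R b - p"] that t by (simp add: h_inv)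
    then show "(x, u) \<in> {(y, w). h w \<in> B y}"
      using B by (simp add: maximal_monotone_iff)
  qed
  then show thesis
    using that[of "h (- y)" y] t by (simp add: h_def)
qed

section \<open>Maximality of the sum\<close>

lemma cocoercive_inner_upper:
  assumes "cocoercive \<alpha> A" and "0 < \<alpha>"
  shows "\<alpha> * inner (x - y) (A x - A y) \<le> (norm (x - y))\<^sup>2"
proof -
  let ?d = "norm (x - y)" and ?D = "norm (A x - A y)"
  have coco: "\<alpha> * ?D\<^sup>2 \<le> inner (x - y) (A x - A y)"
    using assms by (simp add: cocoercive_def)
  have cs: "inner (x - y) (A x - A y) \<le> ?d * ?D" by (rule norm_cauchy_schwarz)
  \<comment> \<open>The Lipschitz bound for \<open>A\<close> with constant
    \<open>1 / \<alpha>\<close>, by cancelling one factor \<open>?D\<close>.\<close>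
  have "\<alpha> * ?D \<le> ?d"
  proof (cases "?D = 0")
    case False
    have "(\<alpha> * ?D) * ?D \<le> ?d * ?D" using coco cs by (simp add: power2_eq_square)
    with False show ?thesis by (simp add: mult_le_cancel_right)
  qed simp
  then have "?d * (\<alpha> * ?D) \<le> ?d * ?d" by (intro mult_left_mono) auto
  moreover have "\<alpha> * inner (x - y) (A x - A y) \<le> \<alpha> * (?d * ?D)"
    using cs \<open>0 < \<alpha>\<close> by simp
  ultimately show ?thesis by (simp add: power2_eq_square mult_ac)
qed

lemma maximal_monotone_cocoercive_sum:
  fixes B :: "'a::{real_inner, complete_space} \<Rightarrow> 'a set"
  assumes A: "cocoercive \<alpha> A" and "0 < \<alpha>" and B: "maximal_monotone B"
  shows "maximal_monotone (op_sum (single_valued_op A) B)"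
  unfolding maximal_monotone_iff
proof (intro conjI allI impI)
  have "0 \<le> \<alpha> * (norm (A x - A y))\<^sup>2" for x y
    using \<open>0 < \<alpha>\<close> by simp
  then have A_mono: "0 \<le> inner (x - y) (A x - A y)" for x y
    using A unfolding cocoercive_def by (meson order_trans)
  show "monotone_operator (op_sum (single_valued_op A) B)"
    unfolding monotone_operator_def
  proof (clarsimp simp: op_sum_def single_valued_op_def)
    fix x y b c assume "b \<in> B x" "c \<in> B y"
    then have "0 \<le> inner (x - y) (b - c)"
      using B by (auto simp: maximal_monotone_def monotone_operator_def)
    then show "0 \<le> inner (x - y) (A x + b - (A y + c))"
      using A_mono[of x y] by (simp add: inner_simps)
  qed
next
  fix x v
  assume rel: "\<forall>y. \<forall>u\<in>op_sum (single_valued_op A) B y. 0 \<le> inner (x - y) (v - u)"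
  \<comment> \<open>With step \<open>\<alpha> / 2\<close>, relatedness and the Lipschitz bound give
    that the squared norm of \<open>x - y\<close> is at most half of itself, hence zero.\<close>
  obtain y b where b: "b \<in> B y" and eq: "y + (\<alpha> / 2) *\<^sub>R b = x + (\<alpha> / 2) *\<^sub>R (v - A x)"
    using minty[OF B half_gt_zero[OF \<open>0 < \<alpha>\<close>]] by metis
  have diff: "x - y = (\<alpha> / 2) *\<^sub>R (b - (v - A x))"
    using eq by (simp add: algebra_simps)
  have "0 \<le> inner (x - y) (v - (A y + b))"
    using rel b by (auto simp: op_sum_def single_valued_op_def)
  also have "\<dots> = inner (x - y) (A x - A y) - inner (x - y) (b - (v - A x))"
    by (simp add: inner_simps)
  finally have "0 \<le> \<alpha> * (inner (x - y) (A x - A y) - inner (x - y) (b - (v - A x)))"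
    using \<open>0 < \<alpha>\<close> by simp
  moreover have "(norm (x - y))\<^sup>2 = \<alpha> / 2 * inner (x - y) (b - (v - A x))"
    unfolding power2_norm_eq_inner by (subst (2) diff) simp
  ultimately have "(norm (x - y))\<^sup>2 \<le> 0"
    using cocoercive_inner_upper[OF A \<open>0 < \<alpha>\<close>, of x y]
    unfolding right_diff_distrib by argo
  then have "x = y" by simp
  then have "v = A x + b" using diff \<open>0 < \<alpha>\<close> by simp
  then show "v \<in> op_sum (single_valued_op A) B x"
    using b \<open>x = y\<close> by (auto simp: op_sum_def single_valued_op_def)
qed

section \<open>Forward-Backward steps as extragradient steps\<close>

lemma forward_step_in_enlargement:
  assumes A: "cocoercive \<alpha> A" and "0 < \<alpha>" and B: "monotone_operator B" and b: "b \<in> B z"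
  shows "A x + b \<in> enlargement (op_sum (single_valued_op A) B) ((norm (z - x))\<^sup>2 / (4 * \<alpha>)) z"
  unfolding enlargement_def
proof (clarsimp simp: op_sum_def single_valued_op_def)
  fix y c assume "c \<in> B y"
  let ?d = "norm (z - x)" and ?D = "norm (A x - A y)"
  \<comment> \<open>\<open>A\<close> is evaluated at \<open>x\<close>, not at \<open>z\<close>,
    which costs at most \<open>?d * ?D\<close>. Over all values of \<open>?D\<close>,
    \<open>\<alpha> * ?D\<^sup>2 - ?d * ?D\<close> is least at \<open>?d / (2 * \<alpha>)\<close>,
    with value minus the claimed enlargement parameter.\<close>
  have "0 \<le> (?d - 2 * \<alpha> * ?D)\<^sup>2 / (4 * \<alpha>)" using \<open>0 < \<alpha>\<close> by simp
  also have "\<dots> = ?d\<^sup>2 / (4 * \<alpha>) + \<alpha> * ?D\<^sup>2 - ?d * ?D"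
    using \<open>0 < \<alpha>\<close> by (simp add: field_simps power2_eq_square)
  finally have "- (?d\<^sup>2 / (4 * \<alpha>)) \<le> \<alpha> * ?D\<^sup>2 - ?d * ?D" by simp
  also have "\<alpha> * ?D\<^sup>2 \<le> inner (x - y) (A x - A y)"
    using A by (simp add: cocoercive_def)
  also have "- (?d * ?D) \<le> inner (z - x) (A x - A y)"
    using Cauchy_Schwarz_ineq2[of "z - x" "A x - A y"] by linarith
  then have "inner (x - y) (A x - A y) - ?d * ?D \<le> inner (z - y) (A x - A y)"
    by (simp add: inner_simps)
  also have "0 \<le> inner (z - y) (b - c)"
    using B b \<open>c \<in> B y\<close> by (auto simp: monotone_operator_def)
  then have "inner (z - y) (A x - A y) \<le> inner (z - y) (A x + b - (A y + c))"
    by (simp add: inner_simps)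
  finally show "- (?d\<^sup>2 / (4 * \<alpha>)) \<le> inner (z - y) (A x + b - (A y + c))" by simp
qed

lemma forward_backward_step:
  assumes "z \<in> resolvent c B (x - c *\<^sub>R A x)" and "c \<noteq> 0"
  obtains b where "b \<in> B z" "inverse c *\<^sub>R (x - z) = A x + b"
proof -
  obtain b where "b \<in> B z" and eq: "x - c *\<^sub>R A x = z + c *\<^sub>R b"
    using assms(1)
    by (auto simp: resolvent_def op_inverse_def op_sum_def single_valued_op_def op_scale_def)
  from eq have "x - z = c *\<^sub>R (A x + b)" by (simp add: algebra_simps)
  then show thesis using that \<open>b \<in> B z\<close> \<open>c \<noteq> 0\<close> by simp
qed

theorem proposition5p3:
  fixes A :: "'a::{real_inner, complete_space} \<Rightarrow> 'a"
    and B :: "'a \<Rightarrow> 'a set"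
    and \<alpha> lam_low lam_up \<sigma> :: real
    and lam \<epsilon> :: "nat \<Rightarrow> real"
    and x0 :: 'a
    and x v :: "nat \<Rightarrow> 'a"
  assumes "\<alpha> > 0" and "cocoercive \<alpha> A" and "maximal_monotone B"
    and "0 < lam_low" and "lam_low \<le> lam_up" and "lam_up < 2 * \<alpha>"
    and "\<And>k. k \<ge> 1 \<Longrightarrow> lam k \<in> {lam_low..lam_up}"
    and "forward_backward A B lam x0 x"
    and "\<sigma> = sqrt (lam_up / (2 * \<alpha>))"
    and "\<And>k. k \<ge> 1 \<Longrightarrow> v k = inverse (lam k) *\<^sub>R (x (k - 1) - x k)"
    and "\<And>k. k \<ge> 1 \<Longrightarrow> \<epsilon> k = (norm (x k - x (k - 1)))\<^sup>2 / (4 * \<alpha>)"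
  shows "0 < \<sigma> \<and> \<sigma> < 1 \<and>
    (\<forall>k\<ge>1.
       v k \<in> enlargement (op_sum (single_valued_op A) B) (\<epsilon> k) (x k) \<and>
       (norm (lam k *\<^sub>R v k + x k - x (k - 1)))\<^sup>2 + 2 * lam k * \<epsilon> k
         \<le> \<sigma>\<^sup>2 * (norm (x k - x (k - 1)))\<^sup>2 \<and>
       x k = x (k - 1) - lam k *\<^sub>R v k) \<and>
    hybrid_proximal_extragradient (op_sum (single_valued_op A) B) \<sigma> lam_low x0 lam v x \<epsilon> x"
proof -
  have \<sigma>: "0 < \<sigma>" "\<sigma> < 1" "\<sigma>\<^sup>2 = lam_up / (2 * \<alpha>)"
    using assms(1,4-6,9) by auto
  \<comment> \<open>The last two conjuncts serve the extragradient predicate.\<close>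
  have "v k \<in> enlargement (op_sum (single_valued_op A) B) (\<epsilon> k) (x k) \<and>
       (norm (lam k *\<^sub>R v k + x k - x (k - 1)))\<^sup>2 + 2 * lam k * \<epsilon> k
         \<le> \<sigma>\<^sup>2 * (norm (x k - x (k - 1)))\<^sup>2 \<and>
       x k = x (k - 1) - lam k *\<^sub>R v k \<and> lam_low \<le> lam k \<and> 0 \<le> \<epsilon> k" if k: "k \<ge> 1" for k
  proof -
    have lam: "lam_low \<le> lam k" "lam k \<le> lam_up" "0 < lam k"
      using assms(7)[OF k] assms(4) by auto
    obtain b where "b \<in> B (x k)" "v k = A (x (k - 1)) + b"
      using assms(8,10) k lam forward_backward_step[of "x k" "lam k" B "x (k - 1)" A]
      by (auto simp: forward_backward_def)
    then have "v k \<in> enlargement (op_sum (single_valued_op A) B) (\<epsilon> k) (x k)"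
      using forward_step_in_enlargement[OF assms(2,1)] assms(3,11) k
      by (simp add: maximal_monotone_def)
    moreover have step: "lam k *\<^sub>R v k = x (k - 1) - x k"
      using assms(10)[OF k] lam by simp
    \<comment> \<open>By \<open>step\<close> the residual
      \<open>lam k *\<^sub>R v k + x k - x (k - 1)\<close> vanishes, so the error criterion reduces
      to this term.\<close>
    moreover have "2 * lam k * \<epsilon> k \<le> \<sigma>\<^sup>2 * (norm (x k - x (k - 1)))\<^sup>2"
    proof -
      have "2 * lam k * \<epsilon> k = lam k / (2 * \<alpha>) * (norm (x k - x (k - 1)))\<^sup>2"
        using assms(11)[OF k] by simp
      also have "\<dots> \<le> \<sigma>\<^sup>2 * (norm (x k - x (k - 1)))\<^sup>2"
        unfolding \<sigma>(3) using lam assms(1) by (intro mult_right_mono divide_right_mono) auto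
      finally show ?thesis .
    qed
    moreover have "0 \<le> \<epsilon> k" using assms(1,11) k by simp
    ultimately show ?thesis using lam by simp
  qed
  moreover have "x 0 = x0" using assms(8) by (simp add: forward_backward_def)
  ultimately show ?thesis
    using \<sigma>(1,2) assms(4) maximal_monotone_cocoercive_sum[OF assms(2,1,3)]
    unfolding hybrid_proximal_extragradient_def by (blast intro: less_imp_le)
qed

end
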